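(* Let $G$ and $H$ be finite, simple, connected graphs, each with at least one edge, with $\zeta(G)>0$ and $\zeta(H)>0$. Let $\varphi_{\mathcal{L}}(G)$ be a Lucky colouring of $G$ with colours $c_1,\dots,c_{\chi(G)}$ and $\varphi_{\mathcal{L}}(H)$ a Lucky colouring of $H$ with colours $c_1,\dots,c_{\chi(H)}$, and let $\theta_G(c_i)$ and $\theta_H(c_j)$ be the numbers of vertices of $G$ and of $H$ receiving colours $c_i$ and $c_j$ in these colourings, respectively. Then the disjoint union $G\cup H$ satisfies $$\zeta(G\cup H)\ \geq\ \zeta(G)+\zeta(H)+\sum_{i=1}^{\chi(G)}\ \sum_{\substack{j=1\\ j\neq i}}^{\chi(H)}\theta_G(c_i)\,\theta_H(c_j).$$
   Context: A chromatic colouring of a graph $G$ is a proper vertex colouring $\varphi$ of $G$ with exactly $\chi(G)$ colours. For a chromatic colouring $\varphi$, let $E_\varphi(G)$ be the set of all pairs $uv$ of distinct non-adjacent vertices of $G$ with $\varphi(u)\neq\varphi(v)$. The chromatic completion number is $\zeta(G)=\max_\varphi |E_\varphi(G)|$, the maximum taken over all chromatic colourings $\varphi$ of $G$ (this definition also applies to the disconnected graph $G\cup H$). A Lucky colouring of $G$ is a chromatic colouring $\varphi$ whose colour classes yield the maximum number of chromatic completion edges, i.e. $|E_\varphi(G)|=\zeta(G)$. *)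

theory Defs
  imports "Graph_Theory.Digraph_Component"
begin

(* A finite simple graph is a pair_graph: a finite, loopless, symmetric set of arcs, where the
   edge uv is the pair of arcs (u, v), (v, u). *)

definition disjoint_union ::
  "'a pair_pre_digraph \<Rightarrow> 'b pair_pre_digraph \<Rightarrow> ('a + 'b) pair_pre_digraph" where
  "disjoint_union G H =
     \<lparr> pverts = pverts G <+> pverts H,
       parcs = map_prod Inl Inl ` parcs G \<union> map_prod Inr Inr ` parcs H \<rparr>"

(* Colours are natural numbers. Colourings are total functions; their values outside the vertex
   set play no role. *)

definition proper_colouring :: "'a pair_pre_digraph \<Rightarrow> ('a \<Rightarrow> nat) \<Rightarrow> bool" where
  "proper_colouring G \<phi> \<longleftrightarrow> (\<forall>(u, v) \<in> parcs G. \<phi> u \<noteq> \<phi> v)"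

definition chromatic_number :: "'a pair_pre_digraph \<Rightarrow> nat" where
  "chromatic_number G = (LEAST k. \<exists>\<phi>. proper_colouring G \<phi> \<and> card (\<phi> ` pverts G) = k)"

definition chromatic_colouring :: "'a pair_pre_digraph \<Rightarrow> ('a \<Rightarrow> nat) \<Rightarrow> bool" where
  "chromatic_colouring G \<phi> \<longleftrightarrow>
     proper_colouring G \<phi> \<and> card (\<phi> ` pverts G) = chromatic_number G"

(* Unordered pairs, so the edges uv and vu are counted once. *)
definition completion_edges :: "'a pair_pre_digraph \<Rightarrow> ('a \<Rightarrow> nat) \<Rightarrow> 'a set set" where
  "completion_edges G \<phi> =
     {{u, v} | u v. u \<in> pverts G \<and> v \<in> pverts G \<and> u \<noteq> v \<and> (u, v) \<notin> parcs G \<and> \<phi> u \<noteq> \<phi> v}"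

definition chromatic_completion_number :: "'a pair_pre_digraph \<Rightarrow> nat" where
  "chromatic_completion_number G =
     Max {card (completion_edges G \<phi>) | \<phi>. chromatic_colouring G \<phi>}"

definition lucky_colouring :: "'a pair_pre_digraph \<Rightarrow> ('a \<Rightarrow> nat) \<Rightarrow> bool" where
  "lucky_colouring G \<phi> \<longleftrightarrow>
     chromatic_colouring G \<phi> \<and>
     card (completion_edges G \<phi>) = chromatic_completion_number G"

definition colour_weight :: "'a pair_pre_digraph \<Rightarrow> ('a \<Rightarrow> nat) \<Rightarrow> nat \<Rightarrow> nat" where
  "colour_weight G \<phi> c = card {v \<in> pverts G. \<phi> v = c}"

(* The maximum defining chromatic_completion_number is over a finite nonempty set. *)

lemma finite_completion_numbers:
  assumes "finite (pverts G)"
  shows "finite {card (completion_edges G \<phi>) | \<phi>. chromatic_colouring G \<phi>}"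
proof -
  have "completion_edges G \<phi> \<in> Pow (Pow (pverts G))" for \<phi>
    by (auto simp: completion_edges_def)
  hence "{card (completion_edges G \<phi>) | \<phi>. chromatic_colouring G \<phi>}
           \<subseteq> card ` Pow (Pow (pverts G))"
    by blast
  thus ?thesis
    using assms by (meson finite_Pow_iff finite_imageI finite_subset)
qed

lemma ex_chromatic_colouring:
  assumes "pair_graph G"
  shows "\<exists>\<phi>. chromatic_colouring G \<phi>"
proof -
  interpret pair_graph G by fact
  obtain f :: "'a \<Rightarrow> nat" where f: "inj_on f (pverts G)"
    using finite_imp_inj_to_nat_seg[OF pair_finite_verts] by blast
  have "proper_colouring G f"
    unfolding proper_colouring_def
    using inj_onD[OF f] in_arcsD1 in_arcsD2 pair_no_loops by fastforce
  hence "\<exists>k \<phi>. proper_colouring G \<phi> \<and> card (\<phi> ` pverts G) = k"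
    by blast
  from LeastI_ex[OF this] show ?thesis
    by (simp add: chromatic_colouring_def chromatic_number_def)
qed

end

theory Submission
  imports Defs
begin

text \<open>
  Colour the two halves of the disjoint union by the two given colourings. Since the colours of
  each form an initial segment of one common list \<^term>\<open>c\<close>, the combined colouring uses only as
  many colours as the larger chromatic number. No proper colouring of the union uses fewer, since
  it restricts to both halves; so the combined colouring is chromatic, and the number of its
  completion edges is a lower bound for the completion number of the union.

  These completion edges are those of the left half, those of the right half, and every pair
  of differently coloured vertices from opposite halves, as no edge joins the halves. The first
  two kinds number exactly the two completion numbers because the given colourings are Lucky. The third
  kind is counted by grouping the pairs according to the colours of their endpoints, which yields
  the double sum.
\<close>

lemma chromatic_number_le:
  assumes "proper_colouring G f"
  shows "chromatic_number G \<le> card (f ` pverts G)"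
  unfolding chromatic_number_def by (rule Least_le) (use assms in blast)

lemma card_completion_edges_le:
  assumes "finite (pverts G)" and "chromatic_colouring G f"
  shows "card (completion_edges G f) \<le> chromatic_completion_number G"
  unfolding chromatic_completion_number_def
  by (rule Max_ge[OF finite_completion_numbers]) (use assms in auto)

lemma finite_completion_edges:
  assumes "finite (pverts G)"
  shows "finite (completion_edges G f)"
  by (rule finite_subset[of _ "Pow (pverts G)"]) (use assms in \<open>auto simp: completion_edges_def\<close>)

lemma pverts_disjoint_union [simp]: "pverts (disjoint_union G H) = pverts G <+> pverts H"
  by (simp add: disjoint_union_def)

lemma parcs_disjoint_union [simp]:
  "(Inl u, Inl u') \<in> parcs (disjoint_union G H) \<longleftrightarrow> (u, u') \<in> parcs G"
  "(Inr v, Inr v') \<in> parcs (disjoint_union G H) \<longleftrightarrow> (v, v') \<in> parcs H"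
  "(Inl u, Inr v) \<notin> parcs (disjoint_union G H)"
  "(Inr v, Inl u) \<notin> parcs (disjoint_union G H)"
  by (auto simp: disjoint_union_def)

lemma proper_colouring_disjoint_union:
  "proper_colouring (disjoint_union G H) f \<longleftrightarrow>
     proper_colouring G (f \<circ> Inl) \<and> proper_colouring H (f \<circ> Inr)"
  by (auto simp: proper_colouring_def disjoint_union_def)

text \<open>Either half alone already forces this many colours, by restriction.\<close>
lemma card_colours_disjoint_union_ge:
  assumes "pair_graph G" and "pair_graph H"
    and f: "proper_colouring (disjoint_union G H) f"
  shows "max (chromatic_number G) (chromatic_number H) \<le> card (f ` pverts (disjoint_union G H))"
proof -
  interpret G: pair_graph G by fact
  interpret H: pair_graph H by fact
  have fin: "finite (f ` pverts (disjoint_union G H))"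
    by simp
  have "chromatic_number G \<le> card ((f \<circ> Inl) ` pverts G)"
    using f by (intro chromatic_number_le) (simp add: proper_colouring_disjoint_union)
  also have "\<dots> \<le> card (f ` pverts (disjoint_union G H))"
    by (rule card_mono[OF fin]) auto
  finally have G: "chromatic_number G \<le> card (f ` pverts (disjoint_union G H))" .
  have "chromatic_number H \<le> card ((f \<circ> Inr) ` pverts H)"
    using f by (intro chromatic_number_le) (simp add: proper_colouring_disjoint_union)
  also have "\<dots> \<le> card (f ` pverts (disjoint_union G H))"
    by (rule card_mono[OF fin]) auto
  finally show ?thesis using G by simp
qed

text \<open>
  No proper colouring of the union has fewer than
  \<^term>\<open>max (chromatic_number G) (chromatic_number H)\<close> colours, so one with exactly that many is
  optimal.
\<close>
lemma chromatic_colouring_disjoint_unionI: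
  assumes "pair_graph G" and "pair_graph H"
    and f: "proper_colouring (disjoint_union G H) f"
    and card: "card (f ` pverts (disjoint_union G H)) = max (chromatic_number G) (chromatic_number H)"
  shows "chromatic_colouring (disjoint_union G H) f"
proof -
  have "chromatic_number (disjoint_union G H) = card (f ` pverts (disjoint_union G H))"
    unfolding chromatic_number_def
  proof (rule Least_equality)
    show "\<exists>g. proper_colouring (disjoint_union G H) g \<and>
        card (g ` pverts (disjoint_union G H)) = card (f ` pverts (disjoint_union G H))"
      using f by blast
  next
    fix k
    assume "\<exists>g. proper_colouring (disjoint_union G H) g \<and>
        card (g ` pverts (disjoint_union G H)) = k"
    thus "card (f ` pverts (disjoint_union G H)) \<le> k"
      unfolding card using card_colours_disjoint_union_ge[OF assms(1,2)] by blast
  qed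
  thus ?thesis using f by (simp add: chromatic_colouring_def)
qed

text \<open>
  Vertices from opposite halves are never adjacent, so for them the only condition left is that
  their colours differ.
\<close>
lemma completion_edges_disjoint_union:
  "completion_edges (disjoint_union G H) (case_sum f g) =
     (`) Inl ` completion_edges G f \<union> (`) Inr ` completion_edges H g \<union>
     (\<lambda>(u, v). {Inl u, Inr v}) ` {(u, v) \<in> pverts G \<times> pverts H. f u \<noteq> g v}"
  (is "?L = ?A \<union> ?B \<union> ?C")
proof
  show "?L \<subseteq> ?A \<union> ?B \<union> ?C"
  proof
    fix e
    assume "e \<in> ?L"
    then obtain x y where e: "e = {x, y}"
      and xy: "x \<in> pverts G <+> pverts H" "y \<in> pverts G <+> pverts H" "x \<noteq> y"
        "(x, y) \<notin> parcs (disjoint_union G H)" "case_sum f g x \<noteq> case_sum f g y"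
      by (auto simp: completion_edges_def)
    show "e \<in> ?A \<union> ?B \<union> ?C"
    proof (cases x)
      case x: (Inl u)
      show ?thesis
      proof (cases y)
        case y: (Inl u')
        have "{u, u'} \<in> completion_edges G f"
          using xy unfolding x y completion_edges_def by auto
        moreover have "e = Inl ` {u, u'}"
          by (simp add: e x y)
        ultimately show ?thesis by blast
      next
        case y: (Inr v)
        show ?thesis using xy unfolding e x y by force
      qed
    next
      case x: (Inr v)
      show ?thesis
      proof (cases y)
        case y: (Inl u)
        show ?thesis using xy unfolding e x y by (force simp: insert_commute)
      next
        case y: (Inr v')
        have "{v, v'} \<in> completion_edges H g"
          using xy unfolding x y completion_edges_def by auto
        moreover have "e = Inr ` {v, v'}"
          by (simp add: e x y)
        ultimately show ?thesis by blast
      qed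
    qed
  qed
  have "?A \<subseteq> ?L"
  proof
    fix e
    assume "e \<in> ?A"
    then obtain u v where "e = {Inl u, Inl v}" "u \<in> pverts G" "v \<in> pverts G" "u \<noteq> v"
      "(u, v) \<notin> parcs G" "f u \<noteq> f v"
      by (auto simp: completion_edges_def)
    thus "e \<in> ?L"
      unfolding completion_edges_def
      by (intro CollectI exI[of _ "Inl u"] exI[of _ "Inl v"]) auto
  qed
  moreover have "?B \<subseteq> ?L"
  proof
    fix e
    assume "e \<in> ?B"
    then obtain u v where "e = {Inr u, Inr v}" "u \<in> pverts H" "v \<in> pverts H" "u \<noteq> v"
      "(u, v) \<notin> parcs H" "g u \<noteq> g v"
      by (auto simp: completion_edges_def)
    thus "e \<in> ?L"
      unfolding completion_edges_def
      by (intro CollectI exI[of _ "Inr u"] exI[of _ "Inr v"]) auto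
  qed
  moreover have "?C \<subseteq> ?L"
  proof
    fix e
    assume "e \<in> ?C"
    then obtain u v where "e = {Inl u, Inr v}" "u \<in> pverts G" "v \<in> pverts H" "f u \<noteq> g v"
      by auto
    thus "e \<in> ?L"
      unfolding completion_edges_def
      by (intro CollectI exI[of _ "Inl u"] exI[of _ "Inr v"]) auto
  qed
  ultimately show "?A \<union> ?B \<union> ?C \<subseteq> ?L" by (intro Un_least)
qed

lemma card_completion_edges_disjoint_union:
  assumes "finite (pverts G)" and "finite (pverts H)"
  shows "card (completion_edges (disjoint_union G H) (case_sum f g)) =
    card (completion_edges G f) + card (completion_edges H g)
      + card {(u, v) \<in> pverts G \<times> pverts H. f u \<noteq> g v}"
proof -
  let ?A = "(`) Inl ` completion_edges G f :: ('a + 'b) set set"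
  let ?B = "(`) Inr ` completion_edges H g :: ('a + 'b) set set"
  let ?P = "{(u, v) \<in> pverts G \<times> pverts H. f u \<noteq> g v}"
  let ?C = "(\<lambda>(u, v). {Inl u, Inr v}) ` ?P :: ('a + 'b) set set"
  have "finite ?P"
    by (rule finite_subset[of _ "pverts G \<times> pverts H"]) (use assms in auto)
  hence fin: "finite ?A" "finite ?B" "finite ?C"
    using assms by (auto intro: finite_completion_edges)
  have disj: "?A \<inter> ?B = {}" "(?A \<union> ?B) \<inter> ?C = {}"
    by (auto simp: completion_edges_def)
  have "card ?A = card (completion_edges G f)"
    by (intro card_image inj_on_image) simp
  moreover have "card ?B = card (completion_edges H g)"
    by (intro card_image inj_on_image) simp
  moreover have "card ?C = card ?P"
    by (rule card_image) (auto simp: inj_on_def doubleton_eq_iff)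
  ultimately show ?thesis
    unfolding completion_edges_disjoint_union
    using fin disj by (simp add: card_Un_disjoint)
qed

text \<open>
  The pairs of vertices with colours \<^term>\<open>c i\<close> and \<^term>\<open>c j\<close> form a product of two colour
  classes. Injectivity of \<^term>\<open>c\<close> on all indices in play makes these products disjoint for
  different index pairs, and turns the condition on the colours into \<^term>\<open>i \<noteq> j\<close>.
\<close>
lemma card_differently_coloured_pairs:
  assumes "finite (pverts G)" and "finite (pverts H)"
    and "inj_on c (I \<union> J)" and "finite I" and "finite J"
    and f: "f ` pverts G = c ` I" and g: "g ` pverts H = c ` J"
  shows "card {(u, v) \<in> pverts G \<times> pverts H. f u \<noteq> g v} =
    (\<Sum>i\<in>I. \<Sum>j\<in>J - {i}. colour_weight G f (c i) * colour_weight H g (c j))"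
proof -
  let ?S = "SIGMA i:I. J - {i}"
  define Q where "Q = (\<lambda>(i, j). {u \<in> pverts G. f u = c i} \<times> {v \<in> pverts H. g v = c j})"
  have inj: "i = j" if "c i = c j" "i \<in> I \<union> J" "j \<in> I \<union> J" for i j
    using inj_onD[OF assms(3)] that .
  have "{(u, v) \<in> pverts G \<times> pverts H. f u \<noteq> g v} = (\<Union>p\<in>?S. Q p)"
  proof
    show "{(u, v) \<in> pverts G \<times> pverts H. f u \<noteq> g v} \<subseteq> (\<Union>p\<in>?S. Q p)"
    proof clarify
      fix u v
      assume uv: "u \<in> pverts G" "v \<in> pverts H" "f u \<noteq> g v"
      have "f u \<in> c ` I" "g v \<in> c ` J"
        using uv(1,2) by (simp_all add: f[symmetric] g[symmetric])
      then obtain i j where ij: "i \<in> I" "f u = c i" "j \<in> J" "g v = c j"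
        by (elim imageE)
      have "(i, j) \<in> ?S" "(u, v) \<in> Q (i, j)"
        using uv ij by (auto simp: Q_def)
      thus "(u, v) \<in> (\<Union>p\<in>?S. Q p)" by (rule UN_I)
    qed
    show "(\<Union>p\<in>?S. Q p) \<subseteq> {(u, v) \<in> pverts G \<times> pverts H. f u \<noteq> g v}"
    proof (rule UN_least)
      fix p
      assume "p \<in> ?S"
      then obtain i j where p: "p = (i, j)" and ij: "i \<in> I" "j \<in> J" "j \<noteq> i"
        by auto
      have "c i \<noteq> c j"
        using ij inj[of i j] by auto
      thus "Q p \<subseteq> {(u, v) \<in> pverts G \<times> pverts H. f u \<noteq> g v}"
        by (auto simp: Q_def p)
    qed
  qed
  also have "card \<dots> = (\<Sum>p\<in>?S. card (Q p))"
  proof (rule card_UN_disjoint)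
    show "\<forall>p\<in>?S. \<forall>q\<in>?S. p \<noteq> q \<longrightarrow> Q p \<inter> Q q = {}"
    proof (intro ballI impI)
      fix p q
      assume "p \<in> ?S" "q \<in> ?S" "p \<noteq> q"
      then obtain i j i' j' where pq: "p = (i, j)" "q = (i', j')"
        and ij: "i \<in> I" "j \<in> J" "i' \<in> I" "j' \<in> J" "i \<noteq> i' \<or> j \<noteq> j'"
        by auto
      have "\<not> (c i = c i' \<and> c j = c j')"
        using ij inj[of i i'] inj[of j j'] by auto
      thus "Q p \<inter> Q q = {}"
        by (auto simp: Q_def pq)
    qed
  qed (simp_all add: Q_def assms split: prod.splits)
  also have "\<dots> = (\<Sum>(i, j)\<in>?S. colour_weight G f (c i) * colour_weight H g (c j))"
    by (intro sum.cong) (auto simp: Q_def colour_weight_def card_cartesian_product)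
  also have "\<dots> = (\<Sum>i\<in>I. \<Sum>j\<in>J - {i}. colour_weight G f (c i) * colour_weight H g (c j))"
    by (rule sum.Sigma[symmetric]) (simp_all add: assms)
  finally show ?thesis .
qed

theorem proposition4p1:
  fixes G :: "'a pair_pre_digraph" and H :: "'b pair_pre_digraph"
    and c :: "nat \<Rightarrow> nat" and \<phi> :: "'a \<Rightarrow> nat" and \<psi> :: "'b \<Rightarrow> nat"
  assumes "pair_graph G" and "pair_graph H"
    and "connected G" and "connected H"
    and "parcs G \<noteq> {}" and "parcs H \<noteq> {}"
    and "chromatic_completion_number G > 0" and "chromatic_completion_number H > 0"
    and "inj_on c {1..max (chromatic_number G) (chromatic_number H)}"
    and "lucky_colouring G \<phi>" and "\<phi> ` pverts G = c ` {1..chromatic_number G}"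
    and "lucky_colouring H \<psi>" and "\<psi> ` pverts H = c ` {1..chromatic_number H}"
  shows "chromatic_completion_number (disjoint_union G H)
    \<ge> chromatic_completion_number G + chromatic_completion_number H
      + (\<Sum>i = 1..chromatic_number G. \<Sum>j \<in> {1..chromatic_number H} - {i}.
           colour_weight G \<phi> (c i) * colour_weight H \<psi> (c j))"
proof -
  interpret G: pair_graph G by fact
  interpret H: pair_graph H by fact
  let ?I = "{1..chromatic_number G}" and ?J = "{1..chromatic_number H}"
  let ?U = "disjoint_union G H" and ?f = "case_sum \<phi> \<psi>"
  have IJ: "?I \<union> ?J = {1..max (chromatic_number G) (chromatic_number H)}"
    by auto
  hence inj: "inj_on c (?I \<union> ?J)"
    using assms(9) by simp
  have "?f ` pverts ?U = \<phi> ` pverts G \<union> \<psi> ` pverts H"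
    by (simp add: Plus_def image_Un image_image)
  also have "\<dots> = c ` (?I \<union> ?J)"
    by (simp only: assms(11,13) image_Un)
  finally have "card (?f ` pverts ?U) = card (?I \<union> ?J)"
    by (simp only: card_image[OF inj])
  hence "card (?f ` pverts ?U) = max (chromatic_number G) (chromatic_number H)"
    unfolding IJ by simp
  moreover have "proper_colouring ?U ?f"
    using assms(10,12)
    by (simp add: proper_colouring_disjoint_union lucky_colouring_def chromatic_colouring_def
      comp_def)
  ultimately have "chromatic_colouring ?U ?f"
    using assms(1,2) by (intro chromatic_colouring_disjoint_unionI)
  hence "card (completion_edges ?U ?f) \<le> chromatic_completion_number ?U"
    by (intro card_completion_edges_le) simp_all
  moreover have "card {(u, v) \<in> pverts G \<times> pverts H. \<phi> u \<noteq> \<psi> v} =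
      (\<Sum>i\<in>?I. \<Sum>j\<in>?J - {i}. colour_weight G \<phi> (c i) * colour_weight H \<psi> (c j))"
    using inj assms(11,13) by (intro card_differently_coloured_pairs) simp_all
  ultimately show ?thesis
    using assms(10,12)
    by (simp add: card_completion_edges_disjoint_union lucky_colouring_def)
qed

end
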